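(* The one-sided kissing numbers satisfy $$B(5)\le 39,\qquad B(6)\le 75,\qquad B(7)\le 135,\qquad B(8)\le 238.$$
   Context: $S^{n-1}$ is the unit sphere in $\mathbb R^n$ with angular distance $\operatorname{dist}$, and $e_n=(0,\dots,0,1)$. The one-sided kissing number $B(n)$ is the maximum size of a finite subset $C$ of the closed hemisphere $\{x\in S^{n-1}:\langle x,e_n\rangle\ge0\}$ such that $\operatorname{dist}(x,y)\ge\pi/3$ for all distinct $x,y\in C$. *)

theory Defs
  imports "HOL-Analysis.Analysis"
begin

text \<open>
  The numeral type \<^typ>\<open>5\<close> has the elements \<open>0 < 1 < \<dots> < 4\<close>, so the coordinate with the
  greatest index is the last one. The order is only used to single out this coordinate.
\<close>

definition last_unit_vector :: "real ^ 'n :: {finite, linorder}"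
  where "last_unit_vector = axis (Max UNIV) 1"

text \<open>The angular distance; meant for unit vectors only.\<close>

definition angular_dist :: "'a :: real_inner \<Rightarrow> 'a \<Rightarrow> real"
  where "angular_dist x y = arccos (x \<bullet> y)"

definition closed_hemisphere :: "(real ^ 'n :: {finite, linorder}) set"
  where "closed_hemisphere = {x \<in> sphere 0 1. x \<bullet> last_unit_vector \<ge> 0}"

definition one_sided_kissing_configuration :: "(real ^ 'n :: {finite, linorder}) set \<Rightarrow> bool"
  where "one_sided_kissing_configuration C \<longleftrightarrow>
    finite C \<and> C \<subseteq> closed_hemisphere \<and>
    (\<forall>x\<in>C. \<forall>y\<in>C. x \<noteq> y \<longrightarrow> angular_dist x y \<ge> pi / 3)"

text \<open>
  \<open>B(n)\<close> is \<open>one_sided_kissing_number TYPE('n)\<close> with \<open>n = CARD('n)\<close>. The set of sizes is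
  finite and nonempty, so \<^const>\<open>Max\<close> is a genuine maximum; see
  \<open>finite_one_sided_kissing_sizes\<close> and \<open>one_sided_kissing_sizes_nonempty\<close>.
\<close>

definition one_sided_kissing_number :: "'n :: {finite, linorder} itself \<Rightarrow> nat"
  where "one_sided_kissing_number _ =
    Max {card C | C :: (real ^ 'n :: {finite, linorder}) set. one_sided_kissing_configuration C}"

lemma one_sided_kissing_sizes_nonempty:
  "{card C | C :: (real ^ 'n :: {finite, linorder}) set. one_sided_kissing_configuration C} \<noteq> {}"
proof -
  have "one_sided_kissing_configuration ({} :: (real ^ 'n :: {finite, linorder}) set)"
    by (simp add: one_sided_kissing_configuration_def)
  then show ?thesis by blast
qed

lemma dist_ge_1_if_angular_dist_ge:
  fixes x y :: "'a :: real_inner"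
  assumes "norm x = 1" "norm y = 1" "angular_dist x y \<ge> pi / 3"
  shows "dist x y \<ge> 1"
proof -
  have "\<bar>x \<bullet> y\<bar> \<le> 1"
    using Cauchy_Schwarz_ineq2[of x y] assms by simp
  then have "cos (arccos (x \<bullet> y)) = x \<bullet> y" "arccos (x \<bullet> y) \<le> pi"
    by (auto simp: abs_le_iff intro!: arccos_ubound)
  moreover have "cos (arccos (x \<bullet> y)) \<le> cos (pi / 3)"
    by (rule cos_monotone_0_pi_le)
      (use assms(3) calculation in \<open>auto simp: angular_dist_def\<close>)
  ultimately have "x \<bullet> y \<le> 1 / 2"
    by (simp add: cos_60)
  moreover have "(dist x y)\<^sup>2 = 2 - 2 * (x \<bullet> y)"
    using assms(1,2)
    by (simp add: dist_norm power2_norm_eq_inner inner_diff_left inner_diff_right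
        inner_commute norm_eq_1)
  ultimately have "1\<^sup>2 \<le> (dist x y)\<^sup>2"
    by simp
  then show ?thesis
    by (rule power2_le_imp_le) simp
qed

lemma finite_one_sided_kissing_sizes:
  "finite {card C | C :: (real ^ 'n :: {finite, linorder}) set. one_sided_kissing_configuration C}"
proof -
  obtain K :: "(real ^ 'n :: {finite, linorder}) set" where K: "finite K" "sphere 0 1 \<subseteq> (\<Union>c\<in>K. ball c (1 / 2))"
    using compact_sphere[of "0 :: real ^ 'n :: {finite, linorder}" 1, unfolded compact_eq_totally_bounded]
    by (meson half_gt_zero_iff zero_less_one)
  have "card C \<le> card K" if C: "one_sided_kissing_configuration C" for C :: "(real ^ 'n :: {finite, linorder}) set"
  proof -
    have sph: "C \<subseteq> sphere 0 1"
      using C by (auto simp: one_sided_kissing_configuration_def closed_hemisphere_def)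
    then have "\<forall>x\<in>C. \<exists>c\<in>K. dist c x < 1 / 2"
      using K(2) by fastforce
    then obtain f where f: "\<And>x. x \<in> C \<Longrightarrow> f x \<in> K \<and> dist (f x) x < 1 / 2"
      by metis
    have "inj_on f C"
    proof (rule inj_onI, rule ccontr)
      fix x y assume xy: "x \<in> C" "y \<in> C" "f x = f y" "x \<noteq> y"
      have "dist x y \<ge> 1"
        using C sph xy
        by (intro dist_ge_1_if_angular_dist_ge)
          (auto simp: one_sided_kissing_configuration_def)
      moreover have "dist x y \<le> dist (f x) x + dist (f x) y"
        by (rule dist_triangle3)
      ultimately show False
        using f[of x] f[of y] xy by simp
    qed
    then show ?thesis
      using f K(1) by (intro card_inj_on_le[of f]) auto
  qed
  then have "{card C | C :: (real ^ 'n :: {finite, linorder}) set. one_sided_kissing_configuration C} \<subseteq> {..card K}"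
    by auto
  then show ?thesis
    by (rule finite_subset) simp
qed

end

theory Submission
  imports Defs
begin

text \<open>
  The proof is Delsarte's linear programming method, strengthened by what a hemisphere says about
  the heights of the points above its boundary. Let \<open>C\<close> be a configuration of \<open>N\<close> points and let
  \<open>f = c\<^sub>0 + c\<^sub>1 G\<^sub>1 + \<dots> + c\<^sub>d G\<^sub>d\<close> be a polynomial with \<open>f \<le> 0\<close> on \<open>[-1, 1/2]\<close>, where
  \<open>G\<^sub>k\<close> is the monic Gegenbauer polynomial of \<open>n\<close>-dimensional space and \<open>c\<^sub>k \<ge> 0\<close> for \<open>k \<ge> 1\<close>. Only
  the diagonal of the double sum of \<open>f (x \<bullet> y)\<close> over \<open>C\<close> contributes positively, so the sum is at
  most \<open>N f(1)\<close>. Every \<open>G\<^sub>k\<close> is positive definite on the sphere (\<open>sos_kernel_zonal\<close>), so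
  Delsarte bounds the sum from below by \<open>c\<^sub>0 N\<^sup>2\<close>, which gives 240 for \<open>n = 8\<close> and is too weak in all
  four dimensions.

  The gain comes from the terms of degree 1 and 2. Positive definiteness, applied to \<open>C\<close>
  together with the pole \<open>e\<close>, is a Cauchy-Schwarz inequality (\<open>sos_kernel_Cauchy_Schwarz\<close>): the
  double sum of \<open>G\<^sub>k (x \<bullet> y)\<close> times \<open>G\<^sub>k 1\<close> is at least the square of the sum of \<open>G\<^sub>k (x \<bullet> e)\<close>. With
  \<open>s\<close> the sum of the squared heights \<open>(x \<bullet> e)\<^sup>2\<close>, the degree 2 term is small only if \<open>s\<close> is close to
  \<open>N / n\<close>. The degree 1 term is small only if the sum of the heights is small, and since
  heights are nonnegative and the points are separated, this forces \<open>s\<close> to be small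
  (\<open>hemisphere_height_inequality\<close>). Both cannot happen. The result is a quadratic inequality in
  \<open>s\<close> (\<open>hemisphere_code_inequality\<close>), which for suitable \<open>f\<close> has no real solution when
  \<open>N\<close> is one more than the claimed bound.

  Positive definiteness of the Gegenbauer polynomials is proved by induction on the degree,
  without integration or spherical harmonics. On harmonic polynomials of degree \<open>k\<close> the operators
  \<open>H \<mapsto> x\<^sub>b H - |x|\<^sup>2 \<partial>\<^sub>b H / (n + 2 k - 2)\<close> produce harmonic polynomials of degree \<open>k + 1\<close>. Applied to both
  arguments of the zonal kernel of degree \<open>k\<close> and summed over the coordinates \<open>b\<close>, they give
  the zonal kernel of degree \<open>k + 1\<close>; and they turn a sum of squares of polynomials into a
  sum of squares of polynomials.
\<close>

section \<open>Zonal kernels and their derivatives\<close>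

text \<open>
  For \<open>n \<ge> 3\<close> the closed form is \<open>(k + 1) (n + k - 2) / ((n + 2 k) (n + 2 k - 2))\<close>. The recursion
  is the one that the induction steps below need, and it makes sense for all \<open>n \<ge> 1\<close>.
\<close>

fun gegenbauer_coeff :: "nat \<Rightarrow> nat \<Rightarrow> real" where
  "gegenbauer_coeff n 0 = 1 / real n"
| "gegenbauer_coeff n (Suc k) = (1 + gegenbauer_coeff n k * (real n + 2 * real k - 2)) / (real n + 2 * real k + 2)"

text \<open>
  The monic Gegenbauer polynomial of index \<open>(n - 2) / 2\<close>, homogenized: with \<open>p = x \<bullet> y\<close> and
  \<open>q = |x|\<^sup>2 |y|\<^sup>2\<close> it is homogeneous and harmonic in each of the vectors \<open>x\<close> and \<open>y\<close>; on unit
  vectors \<open>q = 1\<close>.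
\<close>

fun gegenbauer :: "nat \<Rightarrow> nat \<Rightarrow> real \<Rightarrow> real \<Rightarrow> real" where
  "gegenbauer n 0 p q = 1"
| "gegenbauer n (Suc 0) p q = p"
| "gegenbauer n (Suc (Suc k)) p q =
     p * gegenbauer n (Suc k) p q - gegenbauer_coeff n k * q * gegenbauer n k p q"

definition zonal :: "nat \<Rightarrow> 'a::euclidean_space \<Rightarrow> 'a \<Rightarrow> real"
  where "zonal k x y = gegenbauer DIM('a) k (x \<bullet> y) ((x \<bullet> x) * (y \<bullet> y))"

lemma zonal_simps:
  fixes x y :: "'a::euclidean_space"
  shows "zonal 0 x y = 1" "zonal (Suc 0) x y = x \<bullet> y"
    "zonal (Suc (Suc k)) x y = (x \<bullet> y) * zonal (Suc k) x y
       - gegenbauer_coeff DIM('a) k * ((x \<bullet> x) * (y \<bullet> y)) * zonal k x y"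
  by (simp_all add: zonal_def)

lemma zonal_commute: "zonal k x y = zonal k y x"
  by (simp add: zonal_def inner_commute mult.commute)

text \<open>
  The derivative of the zonal kernel in the direction \<open>v\<close>, in the first argument and then in both
  arguments. They are given by recursion, so that the identities below can be
  proved along the recursion of the kernel itself.
\<close>

fun zonal_deriv :: "nat \<Rightarrow> 'a::euclidean_space \<Rightarrow> 'a \<Rightarrow> 'a \<Rightarrow> real" where
  "zonal_deriv 0 v x y = 0"
| "zonal_deriv (Suc 0) v x y = v \<bullet> y"
| "zonal_deriv (Suc (Suc k)) v x y =
     (v \<bullet> y) * zonal (Suc k) x y + (x \<bullet> y) * zonal_deriv (Suc k) v x y
     - gegenbauer_coeff DIM('a) k * (y \<bullet> y)
         * (2 * (x \<bullet> v) * zonal k x y + (x \<bullet> x) * zonal_deriv k v x y)"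

fun zonal_deriv2 :: "nat \<Rightarrow> 'a::euclidean_space \<Rightarrow> 'a \<Rightarrow> 'a \<Rightarrow> real" where
  "zonal_deriv2 0 v x y = 0"
| "zonal_deriv2 (Suc 0) v x y = v \<bullet> v"
| "zonal_deriv2 (Suc (Suc k)) v x y =
     (v \<bullet> v) * zonal (Suc k) x y + (v \<bullet> y) * zonal_deriv (Suc k) v y x
     + (x \<bullet> v) * zonal_deriv (Suc k) v x y + (x \<bullet> y) * zonal_deriv2 (Suc k) v x y
     - gegenbauer_coeff DIM('a) k
         * (2 * (y \<bullet> v) * (2 * (x \<bullet> v) * zonal k x y + (x \<bullet> x) * zonal_deriv k v x y)
            + (y \<bullet> y) * (2 * (x \<bullet> v) * zonal_deriv k v y x + (x \<bullet> x) * zonal_deriv2 k v x y))"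

lemma has_real_derivative_zonal:
  "((\<lambda>h. zonal k (x + h *\<^sub>R v) y) has_real_derivative zonal_deriv k v x y) (at 0)"
  by (induction k rule: induct_nat_012)
    (auto simp: zonal_simps inner_simps algebra_simps inner_commute
      intro!: derivative_eq_intros)

lemma has_real_derivative_zonal2:
  "((\<lambda>h. zonal_deriv k v x (y + h *\<^sub>R v)) has_real_derivative zonal_deriv2 k v x y) (at 0)"
proof (induction k rule: induct_nat_012)
  case (ge2 k)
  have z: "((\<lambda>h. zonal j x (y + h *\<^sub>R v)) has_real_derivative zonal_deriv j v y x) (at 0)" for j
    using has_real_derivative_zonal[of j y v x] by (simp add: zonal_commute)
  show ?case
    by (rule derivative_eq_intros z ge2 refl | simp only: zonal_deriv.simps inner_simps)+
      (simp add: algebra_simps inner_commute)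
qed (auto simp: inner_simps intro!: derivative_eq_intros)

lemma sum_inner_mult_zonal_deriv:
  "(\<Sum>b\<in>Basis. (w \<bullet> b) * zonal_deriv k b x y) = zonal_deriv k w x y"
proof (induction k rule: induct_nat_012)
  case (ge2 k)
  have "zonal_deriv (Suc (Suc k)) w x y =
     (\<Sum>b\<in>Basis. (w \<bullet> b) * (b \<bullet> y)) * zonal (Suc k) x y
     + (x \<bullet> y) * (\<Sum>b\<in>Basis. (w \<bullet> b) * zonal_deriv (Suc k) b x y)
     - gegenbauer_coeff DIM('a) k * (y \<bullet> y)
         * (2 * (\<Sum>b\<in>Basis. (w \<bullet> b) * (x \<bullet> b)) * zonal k x y
            + (x \<bullet> x) * (\<Sum>b\<in>Basis. (w \<bullet> b) * zonal_deriv k b x y))"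
    using ge2 euclidean_inner[of w y] euclidean_inner[of w x]
    by (simp add: inner_commute)
  also have "\<dots> = (\<Sum>b\<in>Basis. (w \<bullet> b) * zonal_deriv (Suc (Suc k)) b x y)"
    by (simp add: sum_distrib_left sum_distrib_right algebra_simps sum.distrib sum_subtractf)
  finally show ?case ..
qed (use euclidean_inner[of w y] in \<open>simp_all add: inner_commute\<close>)

text \<open>Euler's identity for a function that is homogeneous of degree \<open>k\<close> in \<open>x\<close>.\<close>

lemma zonal_deriv_radial: "zonal_deriv k x x y = real k * zonal k x y"
  by (induction k rule: induct_nat_012) (simp_all add: zonal_simps algebra_simps)

lemma gegenbauer_coeff_Suc_mult:
  "gegenbauer_coeff n (Suc k) * (real n + 2 * real k + 2)
     = 1 + gegenbauer_coeff n k * (real n + 2 * real k - 2)"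
proof -
  have "real n + 2 * real k + 2 \<noteq> 0" by linarith
  then show ?thesis by simp
qed

lemma gegenbauer_coeff_1:
  "n > 0 \<Longrightarrow> gegenbauer_coeff n (Suc 0) * (real n + 2) = 2 - 2 / real n"
  using gegenbauer_coeff_Suc_mult[of n 0] by (simp add: diff_divide_distrib algebra_simps del: gegenbauer_coeff.simps(2))

text \<open>
  In the induction step the three-term recurrence eliminates the kernel of lowest degree. All
  multiples of \<open>x \<bullet> y\<close> then cancel, and the coefficient that is left is the right one by
  \<open>gegenbauer_coeff_Suc_mult\<close>.
\<close>

lemma zonal_deriv_lowering:
  fixes x y :: "'a::euclidean_space"
  shows "zonal_deriv (Suc k) y x y
    = gegenbauer_coeff DIM('a) k * (real DIM('a) + 2 * real k) * (y \<bullet> y) * zonal k x y"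
proof (induction k rule: induct_nat_012)
  case 0
  show ?case by (simp add: zonal_simps)
next
  case 1
  have "zonal_deriv (Suc (Suc 0)) y x y = (2 - 2 / real DIM('a)) * (y \<bullet> y) * (x \<bullet> y)"
    by (simp add: zonal_simps algebra_simps)
  then show ?case
    using gegenbauer_coeff_1[of "DIM('a)"] by (simp add: zonal_simps del: gegenbauer_coeff.simps zonal_deriv.simps)
next
  case (ge2 k)
  define n where "n = real DIM('a)"
  define g where "g = gegenbauer_coeff DIM('a)"
  have g2: "g (Suc (Suc k)) * (n + 2 * real k + 4) = 1 + g (Suc k) * (n + 2 * real k)"
    using gegenbauer_coeff_Suc_mult[of "DIM('a)" "Suc k"]
    by (simp only: n_def g_def of_nat_Suc) (simp add: algebra_simps)
  have Z: "zonal (Suc (Suc k)) x y = (x \<bullet> y) * zonal (Suc k) x y - g k * ((x \<bullet> x) * (y \<bullet> y)) * zonal k x y"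
    by (simp add: zonal_simps g_def)
  have IH: "zonal_deriv (Suc k) y x y = g k * (n + 2 * real k) * (y \<bullet> y) * zonal k x y"
    "zonal_deriv (Suc (Suc k)) y x y = g (Suc k) * (n + 2 * real k + 2) * (y \<bullet> y) * zonal (Suc k) x y"
    using ge2 by (simp_all only: n_def g_def of_nat_Suc) (simp_all add: algebra_simps)
  have "zonal_deriv (Suc (Suc (Suc k))) y x y =
     (y \<bullet> y) * zonal (Suc (Suc k)) x y + (x \<bullet> y) * zonal_deriv (Suc (Suc k)) y x y
     - g (Suc k) * (y \<bullet> y) * (2 * (x \<bullet> y) * zonal (Suc k) x y + (x \<bullet> x) * zonal_deriv (Suc k) y x y)"
    by (simp only: zonal_deriv.simps g_def)
  also have "\<dots> = (1 + g (Suc k) * (n + 2 * real k)) * (y \<bullet> y) * zonal (Suc (Suc k)) x y"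
    unfolding IH Z by algebra
  finally show ?case
    by (simp only: g2[symmetric]) (simp add: g_def n_def algebra_simps del: zonal_deriv.simps gegenbauer_coeff.simps)
qed

lemma sum_zonal_deriv2_rec:
  fixes x y :: "'a::euclidean_space"
  shows "(\<Sum>b\<in>Basis. zonal_deriv2 (Suc (Suc k)) b x y) =
    (real DIM('a) + 2 * (real k + 1)) * zonal (Suc k) x y
    + (x \<bullet> y) * (\<Sum>b\<in>Basis. zonal_deriv2 (Suc k) b x y)
    - gegenbauer_coeff DIM('a) k
       * (4 * (x \<bullet> y) * zonal k x y + 2 * (x \<bullet> x) * zonal_deriv k y x y
          + 2 * (y \<bullet> y) * zonal_deriv k x y x
          + (x \<bullet> x) * (y \<bullet> y) * (\<Sum>b\<in>Basis. zonal_deriv2 k b x y))"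
proof -
  have "(\<Sum>b\<in>Basis. zonal_deriv2 (Suc (Suc k)) b x y) =
     (\<Sum>b\<in>(Basis::'a set). b \<bullet> b) * zonal (Suc k) x y
     + (\<Sum>b\<in>Basis. (y \<bullet> b) * zonal_deriv (Suc k) b y x)
     + (\<Sum>b\<in>Basis. (x \<bullet> b) * zonal_deriv (Suc k) b x y)
     + (x \<bullet> y) * (\<Sum>b\<in>Basis. zonal_deriv2 (Suc k) b x y)
     - gegenbauer_coeff DIM('a) k
         * (4 * (\<Sum>b\<in>Basis. (x \<bullet> b) * (y \<bullet> b)) * zonal k x y
            + 2 * (x \<bullet> x) * (\<Sum>b\<in>Basis. (y \<bullet> b) * zonal_deriv k b x y)
            + 2 * (y \<bullet> y) * (\<Sum>b\<in>Basis. (x \<bullet> b) * zonal_deriv k b y x)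
            + (x \<bullet> x) * (y \<bullet> y) * (\<Sum>b\<in>Basis. zonal_deriv2 k b x y))"
    by (simp add: sum_distrib_left sum_distrib_right algebra_simps sum.distrib sum_subtractf inner_commute)
  also have "(\<Sum>b\<in>(Basis::'a set). b \<bullet> b) = real DIM('a)"
    by (simp add: inner_same_Basis)
  also have "(\<Sum>b\<in>Basis. (x \<bullet> b) * (y \<bullet> b)) = x \<bullet> y"
    by (simp add: euclidean_inner[of x y])
  finally show ?thesis
    unfolding sum_inner_mult_zonal_deriv zonal_deriv_radial
    by (simp add: zonal_commute[of _ y x] algebra_simps)
qed

text \<open>
  Like \<open>zonal_deriv_lowering\<close>, by the same use of the three-term recurrence. With \<open>g\<close> and \<open>g m\<close>
  for the coefficients of the recurrence and of \<open>zonal_deriv_lowering\<close>, the factor here is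
  \<open>g m\<^sup>2\<close>. Hence in \<open>sos_kernel_zonal\<close>, where derivatives are divided by \<open>m\<close>, the two mixed terms
  contribute \<open>-2 g\<close> and the second derivatives \<open>g\<close>, which leaves the \<open>-g\<close> of the recurrence.
\<close>

lemma sum_zonal_deriv2:
  fixes x y :: "'a::euclidean_space"
  shows "(\<Sum>b\<in>Basis. zonal_deriv2 (Suc k) b x y)
    = gegenbauer_coeff DIM('a) k * (real DIM('a) + 2 * real k)^2 * zonal k x y"
proof (induction k rule: induct_nat_012)
  case 0
  show ?case by (simp add: zonal_simps power2_eq_square)
next
  case 1
  have "gegenbauer_coeff DIM('a) (Suc 0) * (real DIM('a) + 2)^2 = (2 - 2 / real DIM('a)) * (real DIM('a) + 2)"
    using gegenbauer_coeff_1[of "DIM('a)"]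
    by (simp add: power2_eq_square mult.assoc[symmetric] del: gegenbauer_coeff.simps)
  also have "\<dots> = 2 * real DIM('a) + 2 - 4 / real DIM('a)"
    by (simp add: field_simps)
  finally have coeff: "gegenbauer_coeff DIM('a) (Suc 0) * (real DIM('a) + 2)^2 = 2 * real DIM('a) + 2 - 4 / real DIM('a)" .
  have "(\<Sum>b\<in>Basis. zonal_deriv2 (Suc (Suc 0)) b x y) = (2 * real DIM('a) + 2 - 4 / real DIM('a)) * (x \<bullet> y)"
    unfolding sum_zonal_deriv2_rec by (simp add: zonal_simps algebra_simps)
  then show ?case
    by (simp add: coeff zonal_simps del: gegenbauer_coeff.simps zonal_deriv2.simps)
next
  case (ge2 k)
  define n where "n = real DIM('a)"
  define g where "g = gegenbauer_coeff DIM('a)"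
  have g2: "g (Suc (Suc k)) * (n + 2 * real k + 4) = 1 + g (Suc k) * (n + 2 * real k)"
    using gegenbauer_coeff_Suc_mult[of "DIM('a)" "Suc k"]
    by (simp only: n_def g_def of_nat_Suc) (simp add: algebra_simps)
  have Z: "zonal (Suc (Suc k)) x y = (x \<bullet> y) * zonal (Suc k) x y - g k * ((x \<bullet> x) * (y \<bullet> y)) * zonal k x y"
    by (simp add: zonal_simps g_def)
  have IH: "(\<Sum>b\<in>Basis. zonal_deriv2 (Suc k) b x y) = g k * (n + 2 * real k)^2 * zonal k x y"
    "(\<Sum>b\<in>Basis. zonal_deriv2 (Suc (Suc k)) b x y) = g (Suc k) * (n + 2 * real k + 2)^2 * zonal (Suc k) x y"
    using ge2 by (simp_all only: n_def g_def of_nat_Suc) (simp_all add: algebra_simps)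
  have low: "zonal_deriv (Suc k) y x y = g k * (n + 2 * real k) * (y \<bullet> y) * zonal k x y"
    "zonal_deriv (Suc k) x y x = g k * (n + 2 * real k) * (x \<bullet> x) * zonal k x y"
    using zonal_deriv_lowering[of k y x] zonal_deriv_lowering[of k x y]
    by (simp_all add: zonal_commute[of k y x] n_def g_def)
  have "(\<Sum>b\<in>Basis. zonal_deriv2 (Suc (Suc (Suc k))) b x y) =
    (n + 2 * (real (Suc k) + 1)) * zonal (Suc (Suc k)) x y
    + (x \<bullet> y) * (g (Suc k) * (n + 2 * real k + 2)^2 * zonal (Suc k) x y)
    - g (Suc k)
       * (4 * (x \<bullet> y) * zonal (Suc k) x y + 2 * (x \<bullet> x) * (g k * (n + 2 * real k) * (y \<bullet> y) * zonal k x y)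
          + 2 * (y \<bullet> y) * (g k * (n + 2 * real k) * (x \<bullet> x) * zonal k x y)
          + (x \<bullet> x) * (y \<bullet> y) * (g k * (n + 2 * real k)^2 * zonal k x y))"
    unfolding sum_zonal_deriv2_rec[of "Suc k"] low IH n_def[symmetric] g_def[symmetric] ..
  also have "\<dots> = (1 + g (Suc k) * (n + 2 * real k)) * (n + 2 * real k + 4) * zonal (Suc (Suc k)) x y"
    unfolding Z by (simp only: of_nat_Suc) algebra
  finally show ?case
    by (simp only: g2[symmetric])
      (simp add: g_def n_def power2_eq_square algebra_simps del: zonal_deriv2.simps gegenbauer_coeff.simps)
qed

section \<open>Positive definiteness of the zonal kernels\<close>

lemma real_polynomial_function_deriv:
  fixes f :: "'a::euclidean_space \<Rightarrow> real"
  assumes "real_polynomial_function f"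
  shows "\<exists>f'. real_polynomial_function f'
    \<and> (\<forall>x. ((\<lambda>h. f (x + h *\<^sub>R v)) has_real_derivative f' x) (at 0))"
  using assms
proof induction
  case (linear f)
  then interpret bounded_linear f .
  show ?case
    by (rule exI[of _ "\<lambda>_. f v"]) (auto simp: add scaleR intro!: derivative_eq_intros)
next
  case (const c)
  show ?case by (rule exI[of _ "\<lambda>_. 0"]) (auto simp: const)
next
  case (add f g)
  then obtain f' g' where
    "real_polynomial_function f'" "\<And>x. ((\<lambda>h. f (x + h *\<^sub>R v)) has_real_derivative f' x) (at 0)"
    "real_polynomial_function g'" "\<And>x. ((\<lambda>h. g (x + h *\<^sub>R v)) has_real_derivative g' x) (at 0)"
    by blast
  then show ?case
    by (intro exI[of _ "\<lambda>x. f' x + g' x"]) (auto intro!: derivative_eq_intros)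
next
  case (mult f g)
  then obtain f' g' where
    "real_polynomial_function f'" "\<And>x. ((\<lambda>h. f (x + h *\<^sub>R v)) has_real_derivative f' x) (at 0)"
    "real_polynomial_function g'" "\<And>x. ((\<lambda>h. g (x + h *\<^sub>R v)) has_real_derivative g' x) (at 0)"
    by blast
  with mult show ?case
    by (intro exI[of _ "\<lambda>x. f' x * g x + f x * g' x"])
      (auto intro!: derivative_eq_intros)
qed

text \<open>
  Positive definiteness is carried through the induction in this stronger form, since
  differentiating in both arguments acts on each square separately.
\<close>

definition sos_kernel :: "('a::euclidean_space \<Rightarrow> 'a \<Rightarrow> real) \<Rightarrow> bool" where
  "sos_kernel K \<longleftrightarrow> (\<exists>fs. (\<forall>f\<in>set fs. real_polynomial_function f)
     \<and> (\<forall>x y. K x y = (\<Sum>f\<leftarrow>fs. f x * f y)))"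

lemma sos_kernel_square:
  "real_polynomial_function f \<Longrightarrow> sos_kernel (\<lambda>x y. f x * f y)"
  unfolding sos_kernel_def by (rule exI[of _ "[f]"]) simp

lemma sos_kernel_add:
  assumes "sos_kernel K" "sos_kernel L"
  shows "sos_kernel (\<lambda>x y. K x y + L x y)"
proof -
  obtain fs gs where "\<forall>f\<in>set fs. real_polynomial_function f" "\<And>x y. K x y = (\<Sum>f\<leftarrow>fs. f x * f y)"
    "\<forall>f\<in>set gs. real_polynomial_function f" "\<And>x y. L x y = (\<Sum>f\<leftarrow>gs. f x * f y)"
    using assms unfolding sos_kernel_def by blast
  then show ?thesis
    unfolding sos_kernel_def by (intro exI[of _ "fs @ gs"]) auto
qed

lemma sos_kernel_sum:
  assumes "finite A" "\<And>a. a \<in> A \<Longrightarrow> sos_kernel (K a)"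
  shows "sos_kernel (\<lambda>x y. \<Sum>a\<in>A. K a x y)"
  using assms
proof (induction A rule: finite_induct)
  case empty
  show ?case unfolding sos_kernel_def by (rule exI[of _ "[]"]) simp
next
  case (insert a A)
  then show ?case using sos_kernel_add[of "K a" "\<lambda>x y. \<Sum>a\<in>A. K a x y"] by simp
qed

lemma DERIV_sum_list:
  assumes "\<And>f. f \<in> set fs \<Longrightarrow> ((\<lambda>h. F f h) has_real_derivative F' f) (at a)"
  shows "((\<lambda>h. \<Sum>f\<leftarrow>fs. F f h) has_real_derivative (\<Sum>f\<leftarrow>fs. F' f)) (at a)"
  using assms by (induction fs) (auto intro!: derivative_eq_intros)

text \<open>
  The kernel obtained by applying the operator \<open>H \<mapsto> p H + q \<partial>\<^sub>v H\<close> to both arguments of \<open>K\<close>. The derivatives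
  of \<open>K\<close> are given without reference to a decomposition into squares, and by uniqueness they agree
  with the termwise ones.
\<close>

lemma sos_kernel_raise:
  assumes K: "sos_kernel K"
    and p: "real_polynomial_function p" and q: "real_polynomial_function q"
    and K1: "\<And>x y. ((\<lambda>h. K (x + h *\<^sub>R v) y) has_real_derivative K1 x y) (at 0)"
    and K2: "\<And>x y. ((\<lambda>h. K1 x (y + h *\<^sub>R v)) has_real_derivative K2 x y) (at 0)"
  shows "sos_kernel (\<lambda>x y. p x * p y * K x y + p x * q y * K1 y x + q x * p y * K1 x y + q x * q y * K2 x y)"
proof -
  obtain fs where fs: "\<And>f. f \<in> set fs \<Longrightarrow> real_polynomial_function f"
    and Kfs: "\<And>x y. K x y = (\<Sum>f\<leftarrow>fs. f x * f y)"
    using K unfolding sos_kernel_def by blast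
  obtain D where D: "\<And>f. f \<in> set fs \<Longrightarrow> real_polynomial_function (D f)"
    "\<And>f x. f \<in> set fs \<Longrightarrow> ((\<lambda>h. f (x + h *\<^sub>R v)) has_real_derivative D f x) (at 0)"
    using real_polynomial_function_deriv[OF fs, where v = v] by metis
  have K1fs: "K1 x y = (\<Sum>f\<leftarrow>fs. D f x * f y)" for x y
  proof (rule DERIV_unique[OF K1])
    show "((\<lambda>h. K (x + h *\<^sub>R v) y) has_real_derivative (\<Sum>f\<leftarrow>fs. D f x * f y)) (at 0)"
      unfolding Kfs by (intro DERIV_sum_list DERIV_cmult_right D)
  qed
  have K2fs: "K2 x y = (\<Sum>f\<leftarrow>fs. D f x * D f y)" for x y
  proof (rule DERIV_unique[OF K2])
    show "((\<lambda>h. K1 x (y + h *\<^sub>R v)) has_real_derivative (\<Sum>f\<leftarrow>fs. D f x * D f y)) (at 0)"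
      unfolding K1fs by (intro DERIV_sum_list DERIV_cmult D)
  qed
  define gs where "gs = map (\<lambda>f x. p x * f x + q x * D f x) fs"
  have "p x * p y * K x y + p x * q y * K1 y x + q x * p y * K1 x y + q x * q y * K2 x y
      = (\<Sum>g\<leftarrow>gs. g x * g y)" for x y
    unfolding Kfs K1fs K2fs gs_def
    by (simp add: o_def algebra_simps sum_list_const_mult[symmetric] sum_list_addf)
  moreover have "\<forall>g\<in>set gs. real_polynomial_function g"
    using p q fs D(1) by (auto simp: gs_def intro!: real_polynomial_function.intros(3,4))
  ultimately show ?thesis unfolding sos_kernel_def by blast
qed

lemma sos_kernel_cong: "sos_kernel K \<Longrightarrow> (\<And>x y. K x y = L x y) \<Longrightarrow> sos_kernel L"
  unfolding sos_kernel_def by simp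

lemma real_polynomial_function_inner_right: "real_polynomial_function (\<lambda>x. x \<bullet> b)"
  by (rule real_polynomial_function.intros(1)) (rule bounded_linear_inner_left)

lemma real_polynomial_function_inner_self:
  "real_polynomial_function (\<lambda>x::'a::euclidean_space. x \<bullet> x)"
proof -
  have "real_polynomial_function (\<lambda>x::'a. \<Sum>b\<in>Basis. (x \<bullet> b) * (x \<bullet> b))"
    by (intro real_polynomial_function_sum real_polynomial_function.intros(4)
        real_polynomial_function_inner_right) auto
  then show ?thesis by (simp add: euclidean_inner[symmetric])
qed

theorem sos_kernel_zonal: "sos_kernel (zonal k :: 'a::euclidean_space \<Rightarrow> 'a \<Rightarrow> real)"
proof (induction k rule: induct_nat_012)
  case 0
  show ?case
    by (rule sos_kernel_cong[OF sos_kernel_square[of "\<lambda>_. 1"]])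
      (auto simp: zonal_simps intro: real_polynomial_function.intros(2))
next
  case 1
  have "sos_kernel (\<lambda>x y::'a. \<Sum>b\<in>Basis. (x \<bullet> b) * (y \<bullet> b))"
    by (intro sos_kernel_sum sos_kernel_square real_polynomial_function_inner_right) auto
  then show ?case
    by (rule sos_kernel_cong) (simp add: zonal_simps euclidean_inner[symmetric])
next
  case (ge2 k)
  \<comment> \<open>The degree of the given kernel is \<open>k + 1\<close>, so the denominator \<open>n + 2 (k + 1) - 2\<close> is \<open>m\<close>.\<close>
  define m where "m = real DIM('a) + 2 * real k"
  define g where "g = gegenbauer_coeff DIM('a) k"
  have "m \<noteq> 0" by (simp add: m_def add_pos_nonneg[THEN less_imp_neq, symmetric])
  let ?p = "\<lambda>b x::'a. x \<bullet> b" and ?q = "\<lambda>x::'a. - (x \<bullet> x) / m"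
  let ?K = "\<lambda>b x y. ?p b x * ?p b y * zonal (Suc k) x y + ?p b x * ?q y * zonal_deriv (Suc k) b y x
    + ?q x * ?p b y * zonal_deriv (Suc k) b x y + ?q x * ?q y * zonal_deriv2 (Suc k) b x y"
  have q: "real_polynomial_function ?q"
    using real_polynomial_function.intros(4)[OF real_polynomial_function.intros(2) real_polynomial_function_inner_self, of "- 1 / m"]
    by simp
  have "sos_kernel (?K b)" for b
    by (rule sos_kernel_raise[OF ge2(2) real_polynomial_function_inner_right q
          has_real_derivative_zonal has_real_derivative_zonal2])
  then have "sos_kernel (\<lambda>x y. \<Sum>b\<in>Basis. ?K b x y)"
    by (intro sos_kernel_sum) auto
  moreover have "(\<Sum>b\<in>Basis. ?K b x y) = zonal (Suc (Suc k)) x y" for x y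
  proof -
    have "(\<Sum>b\<in>Basis. ?K b x y) =
      (\<Sum>b\<in>Basis. (x \<bullet> b) * (y \<bullet> b)) * zonal (Suc k) x y
      + ?q y * (\<Sum>b\<in>Basis. (x \<bullet> b) * zonal_deriv (Suc k) b y x)
      + ?q x * (\<Sum>b\<in>Basis. (y \<bullet> b) * zonal_deriv (Suc k) b x y)
      + ?q x * ?q y * (\<Sum>b\<in>Basis. zonal_deriv2 (Suc k) b x y)"
      unfolding sum.distrib sum_distrib_left sum_distrib_right
      by (intro arg_cong2[where f = "(+)"] sum.cong refl) simp_all
    also have "(\<Sum>b\<in>Basis. (x \<bullet> b) * (y \<bullet> b)) = x \<bullet> y"
      by (simp add: euclidean_inner[of x y])
    also have "(\<Sum>b\<in>Basis. (x \<bullet> b) * zonal_deriv (Suc k) b y x) = g * m * (x \<bullet> x) * zonal k x y"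
      by (simp add: sum_inner_mult_zonal_deriv zonal_deriv_lowering g_def m_def zonal_commute[of k y x])
    also have "(\<Sum>b\<in>Basis. (y \<bullet> b) * zonal_deriv (Suc k) b x y) = g * m * (y \<bullet> y) * zonal k x y"
      by (simp add: sum_inner_mult_zonal_deriv zonal_deriv_lowering g_def m_def)
    also have "(\<Sum>b\<in>Basis. zonal_deriv2 (Suc k) b x y) = g * m^2 * zonal k x y"
      by (simp add: sum_zonal_deriv2 g_def m_def)
    finally show ?thesis
      using \<open>m \<noteq> 0\<close> by (simp add: zonal_simps g_def[symmetric] field_simps power2_eq_square)
  qed
  ultimately show ?case by (rule sos_kernel_cong)
qed

section \<open>Configurations in a hemisphere\<close>

text \<open>The second form adds the point \<open>e\<close>, with weight \<open>a\<close>, to the weighted points of \<open>C\<close>.\<close>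

lemma sos_kernel_quadratic_form_nonneg:
  assumes "sos_kernel K" "finite C"
  shows "0 \<le> (\<Sum>x\<in>C. \<Sum>y\<in>C. w x * w y * K x y)"
    and "0 \<le> (\<Sum>x\<in>C. \<Sum>y\<in>C. w x * w y * K x y) + 2 * a * (\<Sum>x\<in>C. w x * K x e) + a\<^sup>2 * K e e"
proof -
  obtain fs where K: "\<And>x y. K x y = (\<Sum>f\<leftarrow>fs. f x * f y)"
    using assms unfolding sos_kernel_def by blast
  have form: "(\<Sum>x\<in>C. \<Sum>y\<in>C. w x * w y * K x y) + 2 * a * (\<Sum>x\<in>C. w x * K x e) + a\<^sup>2 * K e e
      = (\<Sum>f\<leftarrow>fs. ((\<Sum>x\<in>C. w x * f x) + a * f e)\<^sup>2)" for a
    unfolding K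
  proof (induction fs)
    case (Cons f fs)
    have "((\<Sum>x\<in>C. w x * f x) + a * f e)\<^sup>2
        = (\<Sum>x\<in>C. \<Sum>y\<in>C. w x * w y * (f x * f y)) + 2 * a * (\<Sum>x\<in>C. w x * (f x * f e)) + a\<^sup>2 * (f e * f e)"
      by (simp add: power2_eq_square sum_product sum_distrib_left sum_distrib_right algebra_simps sum.distrib)
    with Cons show ?case
      by (simp add: algebra_simps sum.distrib)
  qed simp
  have nonneg: "0 \<le> (\<Sum>f\<leftarrow>fs. ((\<Sum>x\<in>C. w x * f x) + a * f e)\<^sup>2)" for a
    by (rule sum_list_nonneg) auto
  show "0 \<le> (\<Sum>x\<in>C. \<Sum>y\<in>C. w x * w y * K x y)"
    using form[of 0] nonneg[of 0] by simp
  show "0 \<le> (\<Sum>x\<in>C. \<Sum>y\<in>C. w x * w y * K x y) + 2 * a * (\<Sum>x\<in>C. w x * K x e) + a\<^sup>2 * K e e"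
    using form[of a] nonneg[of a] by simp
qed

lemma sos_kernel_Cauchy_Schwarz:
  assumes "sos_kernel K" "finite C" "K e e > 0"
  shows "(\<Sum>x\<in>C. w x * K x e)\<^sup>2 \<le> K e e * (\<Sum>x\<in>C. \<Sum>y\<in>C. w x * w y * K x y)"
proof -
  let ?L = "\<Sum>x\<in>C. w x * K x e"
  have "0 \<le> K e e * ((\<Sum>x\<in>C. \<Sum>y\<in>C. w x * w y * K x y)
      + 2 * (- ?L / K e e) * ?L + (- ?L / K e e)\<^sup>2 * K e e)"
    using assms by (intro mult_nonneg_nonneg sos_kernel_quadratic_form_nonneg) auto
  also have "\<dots> = K e e * (\<Sum>x\<in>C. \<Sum>y\<in>C. w x * w y * K x y) - ?L\<^sup>2"
    using assms(3) by (simp add: field_simps power2_eq_square)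
  finally show ?thesis by simp
qed

text \<open>
  Give each point its height as weight. The weighted sum of the points has length at least its own
  height, which is the sum of the squared heights. Its squared length is bounded from above
  because all inner products off the diagonal are at most \<open>1/2\<close>; this direction uses that the
  weights are nonnegative.
\<close>

lemma hemisphere_height_inequality:
  fixes C :: "'a::euclidean_space set"
  assumes C: "finite C" and unit: "\<And>x. x \<in> C \<Longrightarrow> norm x = 1" and e: "norm e = 1"
    and hemisphere: "\<And>x. x \<in> C \<Longrightarrow> 0 \<le> x \<bullet> e"
    and separated: "\<And>x y. x \<in> C \<Longrightarrow> y \<in> C \<Longrightarrow> x \<noteq> y \<Longrightarrow> x \<bullet> y \<le> 1 / 2"
  shows "2 * (\<Sum>x\<in>C. (x \<bullet> e)\<^sup>2)\<^sup>2 - (\<Sum>x\<in>C. (x \<bullet> e)\<^sup>2) \<le> (\<Sum>x\<in>C. x \<bullet> e)\<^sup>2"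
proof -
  define s where "s = (\<Sum>x\<in>C. (x \<bullet> e)\<^sup>2)"
  have ee: "e \<bullet> e = 1" "e \<noteq> 0" using e by (auto simp: norm_eq_1)
  have "s\<^sup>2 \<le> (\<Sum>x\<in>C. \<Sum>y\<in>C. (x \<bullet> e) * (y \<bullet> e) * (x \<bullet> y))"
    using sos_kernel_Cauchy_Schwarz[OF sos_kernel_zonal[of "Suc 0"] C, where e = e and w = "\<lambda>x. x \<bullet> e"] ee
    by (simp add: zonal_simps s_def power2_eq_square)
  also have "\<dots> \<le> (\<Sum>x\<in>C. \<Sum>y\<in>C. (x \<bullet> e) * (y \<bullet> e) * (1 / 2 + (if x = y then 1 / 2 else 0)))"
    using separated hemisphere unit by (intro sum_mono mult_left_mono) (auto simp: norm_eq_1)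
  also have "\<dots> = (\<Sum>x\<in>C. \<Sum>y\<in>C. (x \<bullet> e) * (y \<bullet> e) / 2)
      + (\<Sum>x\<in>C. \<Sum>y\<in>C. if x = y then (x \<bullet> e)\<^sup>2 / 2 else 0)"
    unfolding sum.distrib[symmetric] by (intro sum.cong refl) (auto simp: power2_eq_square)
  also have "\<dots> = (\<Sum>x\<in>C. x \<bullet> e)\<^sup>2 / 2 + s / 2"
    using C by (simp add: s_def power2_eq_square sum_product sum_divide_distrib)
  finally show ?thesis unfolding s_def[symmetric] by simp
qed

text \<open>
  The terms of degree at least 3 are dropped, as in Delsarte's bound; those of degree 1 and 2 are
  bounded through the heights.
\<close>

lemma hemisphere_code_inequality:
  fixes C :: "'a::euclidean_space set" and f :: "real \<Rightarrow> real"
  assumes C: "finite C" and unit: "\<And>x. x \<in> C \<Longrightarrow> norm x = 1" and e: "norm e = 1"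
    and hemisphere: "\<And>x. x \<in> C \<Longrightarrow> 0 \<le> x \<bullet> e"
    and separated: "\<And>x y. x \<in> C \<Longrightarrow> y \<in> C \<Longrightarrow> x \<noteq> y \<Longrightarrow> x \<bullet> y \<le> 1 / 2"
    and n: "n = DIM('a)" "n \<ge> 2"
    and d: "d \<ge> 2" and c: "\<And>k. 0 < k \<Longrightarrow> k \<le> d \<Longrightarrow> 0 \<le> c k"
    and f: "\<And>t. f t = (\<Sum>k\<le>d. c k * gegenbauer n k t 1)"
    and f_nonpos: "\<And>t. -1 \<le> t \<Longrightarrow> t \<le> 1 / 2 \<Longrightarrow> f t \<le> 0"
  obtains s where
    "c 0 * (real (card C))\<^sup>2 + c 1 * (2 * s\<^sup>2 - s) + c 2 * (n / (real n - 1) * (s - card C / n)\<^sup>2)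
      \<le> card C * f 1"
proof
  define N where "N = real (card C)"
  define s where "s = (\<Sum>x\<in>C. (x \<bullet> e)\<^sup>2)"
  define P where "P k = (\<Sum>x\<in>C. \<Sum>y\<in>C. zonal k x y)" for k
  have zonal: "zonal k x y = gegenbauer n k (x \<bullet> y) 1" if "norm x = 1" "norm y = 1" for k and x y :: 'a
    using that by (simp add: zonal_def n norm_eq_1)
  have zonal2: "zonal 2 x e = (x \<bullet> e)\<^sup>2 - 1 / n" if "norm x = 1" for x :: 'a
    using that e by (simp add: zonal numeral_2_eq_2 power2_eq_square)
  have ee: "e \<bullet> e = 1" "e \<noteq> 0" using e by (auto simp: norm_eq_1)
  have nn: "1 - 1 / real n > 0" using n(2) by simp
  have P_nonneg: "0 \<le> P k" for k
    using sos_kernel_quadratic_form_nonneg(1)[OF sos_kernel_zonal[of k] C, where w = "\<lambda>_. 1"]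
    by (simp add: P_def)
  have P0: "P 0 = N\<^sup>2"
    by (simp add: P_def zonal_simps N_def power2_eq_square)
  have "(\<Sum>x\<in>C. x \<bullet> e)\<^sup>2 \<le> P 1"
    using sos_kernel_Cauchy_Schwarz[OF sos_kernel_zonal[of 1] C, where w = "\<lambda>_. 1" and e = e] ee
    by (simp add: P_def zonal_simps)
  then have P1: "2 * s\<^sup>2 - s \<le> P 1"
    using hemisphere_height_inequality[OF C unit e hemisphere separated] by (simp add: s_def)
  have "(\<Sum>x\<in>C. zonal 2 x e) = s - N / n"
    by (simp add: zonal2 unit s_def N_def sum_subtractf)
  moreover have "zonal 2 e e = 1 - 1 / n"
    using zonal2[OF e] e by (simp add: norm_eq_1)
  ultimately have "(s - N / n)\<^sup>2 \<le> (1 - 1 / n) * P 2"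
    using sos_kernel_Cauchy_Schwarz[OF sos_kernel_zonal[of 2] C, where w = "\<lambda>_. 1" and e = e] nn
    by (simp add: P_def)
  then have "(s - N / n)\<^sup>2 / (1 - 1 / n) \<le> P 2"
    using nn by (simp add: pos_divide_le_eq mult.commute)
  also have "(s - N / n)\<^sup>2 / (1 - 1 / n) = n / (real n - 1) * (s - N / n)\<^sup>2"
    using n(2) by (simp add: field_simps)
  finally have P2: "n / (real n - 1) * (s - N / n)\<^sup>2 \<le> P 2" .
  have "c 0 * N\<^sup>2 + c 1 * (2 * s\<^sup>2 - s) + c 2 * (n / (real n - 1) * (s - N / n)\<^sup>2)
      \<le> c 0 * P 0 + c 1 * P 1 + c 2 * P 2"
    unfolding P0 using P1 P2 c[of 1] c[of 2] d by (intro add_mono order_refl mult_left_mono) auto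
  also have "\<dots> = (\<Sum>k\<in>{0, 1, 2}. c k * P k)" by simp
  also have "\<dots> \<le> (\<Sum>k\<le>d. c k * P k)"
    using d c P_nonneg by (intro sum_mono2) auto
  also have "\<dots> = (\<Sum>x\<in>C. \<Sum>y\<in>C. f (x \<bullet> y))"
  proof -
    have "(\<Sum>x\<in>C. \<Sum>y\<in>C. f (x \<bullet> y)) = (\<Sum>x\<in>C. \<Sum>y\<in>C. \<Sum>k\<le>d. c k * zonal k x y)"
      by (simp add: f zonal unit)
    also have "\<dots> = (\<Sum>x\<in>C. \<Sum>k\<le>d. \<Sum>y\<in>C. c k * zonal k x y)"
      by (intro sum.cong refl sum.swap)
    also have "\<dots> = (\<Sum>k\<le>d. \<Sum>x\<in>C. \<Sum>y\<in>C. c k * zonal k x y)"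
      by (rule sum.swap)
    finally show ?thesis by (simp add: P_def sum_distrib_left)
  qed
  also have "\<dots> \<le> (\<Sum>x\<in>C. f 1)"
  proof (rule sum_mono)
    fix x assume x: "x \<in> C"
    have "(\<Sum>y\<in>C. f (x \<bullet> y)) = f (x \<bullet> x) + (\<Sum>y\<in>C - {x}. f (x \<bullet> y))"
      using C x by (simp add: sum.remove)
    moreover have "(\<Sum>y\<in>C - {x}. f (x \<bullet> y)) \<le> 0"
    proof (rule sum_nonpos)
      fix y assume y: "y \<in> C - {x}"
      have "\<bar>x \<bullet> y\<bar> \<le> 1" using Cauchy_Schwarz_ineq2[of x y] unit x y by simp
      then show "f (x \<bullet> y) \<le> 0"
        using separated[of x y] x y by (intro f_nonpos) auto
    qed
    ultimately show "(\<Sum>y\<in>C. f (x \<bullet> y)) \<le> f 1"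
      using unit[OF x] by (simp add: norm_eq_1)
  qed
  finally show "c 0 * (real (card C))\<^sup>2 + c 1 * (2 * s\<^sup>2 - s) + c 2 * (n / (real n - 1) * (s - card C / n)\<^sup>2)
      \<le> card C * f 1"
    by (simp add: N_def)
qed

text \<open>
  Every subset of a configuration is a configuration, so it is enough to exclude the size
  \<open>M + 1\<close>. Then \<open>N\<close> is a fixed number and only a quadratic inequality in \<open>s\<close> remains to be refuted.
\<close>

lemma one_sided_kissing_number_le:
  fixes c :: "nat \<Rightarrow> real" and f :: "real \<Rightarrow> real"
  assumes n: "n = CARD('n::{finite, linorder})" "n \<ge> 2"
    and d: "d \<ge> 2" and c: "\<And>k. 0 < k \<Longrightarrow> k \<le> d \<Longrightarrow> 0 \<le> c k"
    and f: "\<And>t. f t = (\<Sum>k\<le>d. c k * gegenbauer n k t 1)"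
    and f_nonpos: "\<And>t. -1 \<le> t \<Longrightarrow> t \<le> 1 / 2 \<Longrightarrow> f t \<le> 0"
    and M: "N = real (Suc M)"
    and bound: "\<And>s. N * f 1
      < c 0 * N\<^sup>2 + c 1 * (2 * s\<^sup>2 - s) + c 2 * (n / (real n - 1) * (s - N / n)\<^sup>2)"
  shows "one_sided_kissing_number TYPE('n) \<le> M"
proof -
  have "card C \<le> M" if "one_sided_kissing_configuration C" for C :: "(real ^ 'n::{finite, linorder}) set"
  proof (rule ccontr)
    assume "\<not> card C \<le> M"
    then obtain D where D: "D \<subseteq> C" "card D = Suc M" "finite D"
      using obtain_subset_with_card_n[of "Suc M" C] by auto
    let ?e = "last_unit_vector :: real ^ 'n::{finite, linorder}"
    have unit: "norm x = 1" and hemisphere: "0 \<le> x \<bullet> ?e" if "x \<in> D" for x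
      using that D(1) \<open>one_sided_kissing_configuration C\<close>
      by (auto simp: one_sided_kissing_configuration_def closed_hemisphere_def)
    have separated: "x \<bullet> y \<le> 1 / 2" if "x \<in> D" "y \<in> D" "x \<noteq> y" for x y
    proof -
      have "pi / 3 \<le> angular_dist x y"
        using that D(1) \<open>one_sided_kissing_configuration C\<close>
        unfolding one_sided_kissing_configuration_def by blast
      then have "1 \<le> dist x y"
        using that unit by (intro dist_ge_1_if_angular_dist_ge)
      then have "1 \<le> (dist x y)\<^sup>2" by (simp add: power2_eq_square mult_ge1_I)
      also have "(dist x y)\<^sup>2 = 2 - 2 * (x \<bullet> y)"
        using unit[OF that(1)] unit[OF that(2)]
        by (simp add: dist_norm power2_norm_eq_inner inner_diff_left inner_diff_right inner_commute norm_eq_1)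
      finally show ?thesis by simp
    qed
    have e: "norm ?e = 1" by (simp add: last_unit_vector_def)
    have n': "n = DIM(real ^ 'n::{finite, linorder})" using n by simp
    obtain s where "c 0 * (real (card D))\<^sup>2 + c 1 * (2 * s\<^sup>2 - s)
        + c 2 * (n / (real n - 1) * (s - card D / n)\<^sup>2) \<le> card D * f 1"
      by (rule hemisphere_code_inequality[OF D(3) _ e _ _ n' n(2) d, where c = c and f = f])
        (assumption | rule unit hemisphere separated c f f_nonpos)+
    with bound[of s] show False by (simp only: D(2) M)
  qed
  then show ?thesis
    unfolding one_sided_kissing_number_def
    using finite_one_sided_kissing_sizes one_sided_kissing_sizes_nonempty by (subst Max_le_iff) auto
qed

section \<open>The polynomials for dimensions 5 to 8\<close>

text \<open>
  The polynomial is close to a numerical optimum of the linear program, rounded to small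
  coefficients. Like the optimum, it has a simple root at \<open>1/2\<close> and double roots inside \<open>[-1, 1/2]\<close>,
  so that its sign is evident.
\<close>

lemma one_sided_kissing_number_5_le: "one_sided_kissing_number TYPE(5) \<le> 39"
proof (rule one_sided_kissing_number_le)
  let ?c = "\<lambda>k. [121/2520, 61/252, 2/3, 41/33, 3/2, 1::real] ! k"
  show "(t - 1 / 2) * (t\<^sup>2 + t + 1 / 6)\<^sup>2 = (\<Sum>k\<le>5. ?c k * gegenbauer 5 k t 1)" for t
    by (simp add: eval_nat_numeral field_simps)
  show "(t - 1 / 2) * (t\<^sup>2 + t + 1 / 6)\<^sup>2 \<le> 0" if "t \<le> 1 / 2" for t :: real
    using that by (intro mult_nonpos_nonneg) auto
  show "0 \<le> ?c k" if "k \<le> 5" for k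
    using that by (auto simp: le_Suc_eq eval_nat_numeral)
  show "40 * ((1 - 1 / 2) * (1\<^sup>2 + 1 + 1 / 6)\<^sup>2)
      < ?c 0 * 40\<^sup>2 + ?c 1 * (2 * s\<^sup>2 - s) + ?c 2 * (real 5 / (real 5 - 1) * (s - 40 / real 5)\<^sup>2)" for s
    \<comment> \<open>The right-hand side, as a quadratic polynomial in \<open>s\<close>, has its minimum at \<open>3421 / 664\<close>;
      the squares in the proofs for the other dimensions are found in the same way.\<close>
    using zero_le_power2[of "s - 3421 / 664"] by (simp add: power2_eq_square field_simps)
qed simp_all

text \<open>
  The polynomial by which Delsarte's method proves the sharp bound 240 for the kissing number in
  dimension 8: its roots are the inner products of distinct minimal vectors of the \<open>E\<^sub>8\<close> lattice,
  normalized to length 1. It is good enough in dimensions 6 and 7, too.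
\<close>

definition e8_polynomial :: "real \<Rightarrow> real"
  where "e8_polynomial t = (t + 1) * (t + 1 / 2)\<^sup>2 * t\<^sup>2 * (t - 1 / 2)"

lemma e8_polynomial_nonpos: "- 1 \<le> t \<Longrightarrow> t \<le> 1 / 2 \<Longrightarrow> e8_polynomial t \<le> 0"
  unfolding e8_polynomial_def by (intro mult_nonneg_nonpos mult_nonneg_nonneg) auto

lemma one_sided_kissing_number_6_le: "one_sided_kissing_number TYPE(6) \<le> 75"
proof (rule one_sided_kissing_number_le)
  let ?c = "\<lambda>k. [5/192, 9/64, 2/5, 7/8, 37/28, 3/2, 1::real] ! k"
  show "e8_polynomial t = (\<Sum>k\<le>6. ?c k * gegenbauer 6 k t 1)" for t
    by (simp add: e8_polynomial_def eval_nat_numeral field_simps)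
  show "0 \<le> ?c k" if "k \<le> 6" for k
    using that by (auto simp: le_Suc_eq eval_nat_numeral)
  show "76 * e8_polynomial 1
      < ?c 0 * 76\<^sup>2 + ?c 1 * (2 * s\<^sup>2 - s) + ?c 2 * (real 6 / (real 6 - 1) * (s - 76 / real 6)\<^sup>2)" for s
    using zero_le_power2[of "s - 19681/2436"] by (simp add: e8_polynomial_def power2_eq_square field_simps)
qed (simp_all add: e8_polynomial_nonpos)

lemma one_sided_kissing_number_7_le: "one_sided_kissing_number TYPE(7) \<le> 135"
proof (rule one_sided_kissing_number_le)
  let ?c = "\<lambda>k. [29/1848, 9/88, 373/1144, 81/104, 5/4, 3/2, 1::real] ! k"
  show "e8_polynomial t = (\<Sum>k\<le>6. ?c k * gegenbauer 7 k t 1)" for t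
    by (simp add: e8_polynomial_def eval_nat_numeral field_simps)
  show "0 \<le> ?c k" if "k \<le> 6" for k
    using that by (auto simp: le_Suc_eq eval_nat_numeral)
  show "136 * e8_polynomial 1
      < ?c 0 * 136\<^sup>2 + ?c 1 * (2 * s\<^sup>2 - s) + ?c 2 * (real 7 / (real 7 - 1) * (s - 136 / real 7)\<^sup>2)" for s
    using zero_le_power2[of "s - 51079/4015"] by (simp add: e8_polynomial_def power2_eq_square field_simps)
qed (simp_all add: e8_polynomial_nonpos)

lemma one_sided_kissing_number_8_le: "one_sided_kissing_number TYPE(8) \<le> 238"
proof (rule one_sided_kissing_number_le)
  let ?c = "\<lambda>k. [3/320, 3/40, 15/56, 39/56, 19/16, 3/2, 1::real] ! k"
  show "e8_polynomial t = (\<Sum>k\<le>6. ?c k * gegenbauer 8 k t 1)" for t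
    by (simp add: e8_polynomial_def eval_nat_numeral field_simps)
  show "0 \<le> ?c k" if "k \<le> 6" for k
    using that by (auto simp: le_Suc_eq eval_nat_numeral)
  show "239 * e8_polynomial 1
      < ?c 0 * 239\<^sup>2 + ?c 1 * (2 * s\<^sup>2 - s) + ?c 2 * (real 8 / (real 8 - 1) * (s - 239 / real 8)\<^sup>2)" for s
    using zero_le_power2[of "s - 11999/596"] by (simp add: e8_polynomial_def power2_eq_square field_simps)
qed (simp_all add: e8_polynomial_nonpos)

theorem mainTheorem7:
  "one_sided_kissing_number TYPE(5) \<le> 39 \<and>
   one_sided_kissing_number TYPE(6) \<le> 75 \<and>
   one_sided_kissing_number TYPE(7) \<le> 135 \<and>
   one_sided_kissing_number TYPE(8) \<le> 238"
  using one_sided_kissing_number_5_le one_sided_kissing_number_6_le one_sided_kissing_number_7_le one_sided_kissing_number_8_le by blast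

end
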